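(* Let $A\subseteq\mathbb{R}$ be an open invex subset with respect to $\eta:A\times A\to\mathbb{R}$. Suppose that $f:A\to\mathbb{R}$ is a three times differentiable function, let $q\ge 1$, and suppose that $|f'''|^{q}$ is prequasiinvex on $A$ with respect to $\eta$. Then for every $a,b\in A$ with $\eta(b,a)\neq 0$, $$\left|\int_{b}^{b+\eta(a,b)}f(x)\,dx-\eta(a,b)\,\frac{f(b)+f(b+\eta(a,b))}{2}-\frac{(\eta(a,b))^{2}}{12}\left[f'(b)-f'(b+\eta(a,b))\right]\right|\le\frac{(\eta(a,b))^{4}}{192}\left[\max\left\{|f'''(a)|^{q},|f'''(b)|^{q}\right\}\right]^{\frac1q}.$$
   Context: A set $A\subseteq\mathbb{R}$ is invex with respect to $\eta:A\times A\to\mathbb{R}$ if $u+t\,\eta(v,u)\in A$ for all $u,v\in A$ and all $t\in[0,1]$. A function $g:A\to\mathbb{R}$ on an invex set $A$ is prequasiinvex with respect to $\eta$ if $g(u+t\,\eta(v,u))\le\max\{g(u),g(v)\}$ for all $u,v\in A$ and all $t\in[0,1]$. Integrals $\int_c^d$ are oriented (the upper limit may be less than the lower limit). *)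

theory Defs
  imports "HOL-Analysis.Analysis"
begin

text \<open>
  Functions given on \<open>A\<close> or on \<open>A \<times> A\<close> are represented by total functions;
  only their values at arguments from \<open>A\<close> are constrained.
\<close>

definition invex_wrt :: "(real \<Rightarrow> real \<Rightarrow> real) \<Rightarrow> real set \<Rightarrow> bool" where
  "invex_wrt \<eta> A \<longleftrightarrow> (\<forall>u\<in>A. \<forall>v\<in>A. \<forall>t\<in>{0..1}. u + t * \<eta> v u \<in> A)"

definition prequasiinvex_on :: "real set \<Rightarrow> (real \<Rightarrow> real \<Rightarrow> real) \<Rightarrow> (real \<Rightarrow> real) \<Rightarrow> bool" where
  "prequasiinvex_on A \<eta> g \<longleftrightarrow>
     (\<forall>u\<in>A. \<forall>v\<in>A. \<forall>t\<in>{0..1}. g (u + t * \<eta> v u) \<le> max (g u) (g v))"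

end

theory Submission
  imports Defs
begin

text \<open>
  Write \<open>h = \<eta> a b\<close>.  The left-hand side is the error of the trapezoidal rule with end-point
  correction on the segment from \<open>b\<close> to \<open>b + h\<close>.  This rule has a Peano kernel: a cubic \<open>p\<close> that
  vanishes at both end points, takes there equal slopes \<open>h\<^sup>2/12\<close>, and has third derivative \<open>1\<close>.
  Integrating \<open>p f'''\<close> by parts three times therefore reproduces exactly \<open>\<integral> f\<close> and the boundary terms
  of the rule, so that the error is \<open>-\<integral> p f'''\<close> (\<open>corrected_trapezoid_remainder\<close>).  The invexity of
  \<open>A\<close> keeps the whole segment inside \<open>A\<close>, and prequasiinvexity bounds \<open>\<bar>f'''\<bar>\<close> on it by the
  power \<open>1/q\<close> of \<open>max {\<bar>f'''(a)\<bar>\<^sup>q, \<bar>f'''(b)\<bar>\<^sup>q}\<close>.  The claim follows because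
  \<open>\<integral> \<bar>p\<bar> = h\<^sup>4/192\<close>.

  The third derivative is assumed to exist, but not to be integrable.  The Henstock--Kurzweil
  integral removes this difficulty: it integrates every derivative, and \<open>p f'''\<close> is a derivative up
  to the continuous summand \<open>f\<close>.

  The sign of \<open>h\<close> is arbitrary, but the rule is odd under exchange of its end points, so the estimate
  on intervals \<open>{c..d}\<close> with \<open>c \<le> d\<close> suffices.
\<close>

definition corrected_trapezoid_kernel :: "real \<Rightarrow> real \<Rightarrow> real \<Rightarrow> real" where
  "corrected_trapezoid_kernel c d x = (x - c) * (x - d) * (2 * x - c - d) / 12"

text \<open>
  The kernel is \<open>w w'/12\<close> for \<open>w x = (x - c) (d - x)\<close>, hence the derivative of \<open>w\<^sup>2/24\<close>.  It is
  nonnegative on the left half of the interval and nonpositive on the right half, so both halves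
  contribute the value of \<open>w\<^sup>2/24\<close> at the midpoint, where \<open>w = (d - c)\<^sup>2/4\<close>.
\<close>

lemma has_integral_abs_corrected_trapezoid_kernel:
  assumes "c \<le> d"
  shows "((\<lambda>x. \<bar>corrected_trapezoid_kernel c d x\<bar>) has_integral (d - c)^4 / 192) {c..d}"
proof -
  define m where "m = (c + d) / 2"
  define W where "W x = ((x - c) * (d - x))^2 / 24" for x
  let ?p = "corrected_trapezoid_kernel c d"
  have cm: "c \<le> m" "m \<le> d"
    using assms by (auto simp: m_def)
  have W': "(W has_real_derivative ?p x) (at x within S)" for x S
    unfolding W_def corrected_trapezoid_kernel_def
    by (auto intro!: derivative_eq_intros simp: field_simps power2_eq_square)
  have Wm: "W m = (d - c)^4 / 384"
    by (simp add: W_def m_def field_simps power2_eq_square power4_eq_xxxx)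
  have left: "((\<lambda>x. \<bar>?p x\<bar>) has_integral W m) {c..m}"
  proof -
    have "(?p has_integral W m - W c) {c..m}"
      using cm W' by (intro fundamental_theorem_of_calculus)
        (auto simp: has_real_derivative_iff_has_vector_derivative[symmetric])
    moreover have "?p x = \<bar>?p x\<bar>" if "x \<in> {c..m}" for x
    proof -
      have "0 \<le> (x - c) * ((d - x) * (c + d - 2 * x))"
        using that cm by (intro mult_nonneg_nonneg) (auto simp: m_def)
      also have "\<dots> = 12 * ?p x"
        by (simp add: corrected_trapezoid_kernel_def field_simps)
      finally show ?thesis
        by simp
    qed
    ultimately show ?thesis
      by (subst has_integral_cong[of _ _ ?p]) (auto simp: W_def)
  qed
  have right: "((\<lambda>x. \<bar>?p x\<bar>) has_integral W m) {m..d}"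
  proof -
    have "((\<lambda>x. - ?p x) has_integral - W d - (- W m)) {m..d}"
      using cm by (intro fundamental_theorem_of_calculus)
        (auto simp: has_real_derivative_iff_has_vector_derivative[symmetric]
          intro!: W' derivative_eq_intros)
    moreover have "- ?p x = \<bar>?p x\<bar>" if "x \<in> {m..d}" for x
    proof -
      have "0 \<le> (x - c) * ((d - x) * (2 * x - c - d))"
        using that cm by (intro mult_nonneg_nonneg) (auto simp: m_def)
      also have "\<dots> = 12 * (- ?p x)"
        by (simp add: corrected_trapezoid_kernel_def field_simps)
      finally show ?thesis
        by simp
    qed
    ultimately show ?thesis
      by (subst has_integral_cong[of _ _ "\<lambda>x. - ?p x"]) (auto simp: W_def)
  qed
  show ?thesis
    using has_integral_combine[OF cm left right] by (simp add: Wm)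
qed

text \<open>
  Three integrations by parts at once: with the cubic kernel \<open>p\<close>, the function
  \<open>p f'' - p' f' + p'' f\<close> has derivative \<open>p f''' + p''' f = p f''' + f\<close>, all mixed terms cancelling.
  Its increment over the interval consists of the boundary terms of the rule, because \<open>p\<close> vanishes
  at the end points, \<open>p'\<close> is \<open>(d - c)\<^sup>2/12\<close> at both of them, and \<open>p''\<close> is \<open>(c - d)/2\<close> at \<open>c\<close> and
  \<open>(d - c)/2\<close> at \<open>d\<close>.
\<close>

lemma corrected_trapezoid_remainder:
  fixes f f1 f2 f3 :: "real \<Rightarrow> real"
  assumes "c \<le> d"
    and f1: "\<And>x. x \<in> {c..d} \<Longrightarrow> (f has_real_derivative f1 x) (at x within {c..d})"
    and f2: "\<And>x. x \<in> {c..d} \<Longrightarrow> (f1 has_real_derivative f2 x) (at x within {c..d})"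
    and f3: "\<And>x. x \<in> {c..d} \<Longrightarrow> (f2 has_real_derivative f3 x) (at x within {c..d})"
  shows "((\<lambda>x. corrected_trapezoid_kernel c d x * f3 x) has_integral
            (d - c) * ((f c + f d) / 2) + (d - c)^2 / 12 * (f1 c - f1 d) - integral {c..d} f) {c..d}"
proof -
  let ?p = "corrected_trapezoid_kernel c d"
  define p1 where "p1 x = ((2 * x - c - d)^2 + 2 * ((x - c) * (x - d))) / 12" for x
  define p2 where "p2 x = x - (c + d) / 2" for x
  define F where "F x = ?p x * f2 x - p1 x * f1 x + p2 x * f x" for x
  have p: "(?p has_real_derivative p1 x) (at x within S)" for x S
    unfolding corrected_trapezoid_kernel_def p1_def
    by (auto intro!: derivative_eq_intros simp: field_simps power2_eq_square)
  have p1: "(p1 has_real_derivative p2 x) (at x within S)" for x S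
    unfolding p1_def p2_def
    by (auto intro!: derivative_eq_intros simp: field_simps power2_eq_square)
  have p2: "(p2 has_real_derivative 1) (at x within S)" for x S
    unfolding p2_def by (auto intro!: derivative_eq_intros)
  have "(F has_real_derivative ?p x * f3 x + f x) (at x within {c..d})" if "x \<in> {c..d}" for x
    unfolding F_def
    by (rule DERIV_cong[OF DERIV_add[OF DERIV_diff[OF DERIV_mult[OF p f3[OF that]]
          DERIV_mult[OF p1 f2[OF that]]] DERIV_mult[OF p2 f1[OF that]]]]) (simp add: algebra_simps)
  then have "((\<lambda>x. ?p x * f3 x + f x) has_integral F d - F c) {c..d}"
    using \<open>c \<le> d\<close> by (intro fundamental_theorem_of_calculus)
      (auto simp: has_real_derivative_iff_has_vector_derivative[symmetric])
  moreover have "(f has_integral integral {c..d} f) {c..d}"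
    using f1 by (intro integrable_integral integrable_continuous_interval DERIV_continuous_on)
  ultimately have "((\<lambda>x. (?p x * f3 x + f x) - f x) has_integral
      (F d - F c) - integral {c..d} f) {c..d}"
    by (rule has_integral_diff)
  moreover have "F d - F c = (d - c) * ((f c + f d) / 2) + (d - c)^2 / 12 * (f1 c - f1 d)"
    by (simp add: F_def corrected_trapezoid_kernel_def p1_def p2_def field_simps power2_eq_square)
  ultimately show ?thesis
    by simp
qed

lemma corrected_trapezoid_error_bound:
  fixes f f1 f2 f3 :: "real \<Rightarrow> real"
  assumes "c \<le> d"
    and "\<And>x. x \<in> {c..d} \<Longrightarrow> (f has_real_derivative f1 x) (at x within {c..d})"
    and "\<And>x. x \<in> {c..d} \<Longrightarrow> (f1 has_real_derivative f2 x) (at x within {c..d})"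
    and "\<And>x. x \<in> {c..d} \<Longrightarrow> (f2 has_real_derivative f3 x) (at x within {c..d})"
    and bound: "\<And>x. x \<in> {c..d} \<Longrightarrow> \<bar>f3 x\<bar> \<le> M"
  shows "\<bar>integral {c..d} f - (d - c) * ((f c + f d) / 2) - (d - c)^2 / 12 * (f1 c - f1 d)\<bar>
         \<le> (d - c)^4 / 192 * M"
proof -
  let ?p = "corrected_trapezoid_kernel c d"
  have remainder: "((\<lambda>x. ?p x * f3 x) has_integral (d - c) * ((f c + f d) / 2)
      + (d - c)^2 / 12 * (f1 c - f1 d) - integral {c..d} f) {c..d}"
    by (rule corrected_trapezoid_remainder[OF assms(1-4)])
  have majorant: "((\<lambda>x. \<bar>?p x\<bar> * M) has_integral (d - c)^4 / 192 * M) {c..d}"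
    by (intro has_integral_mult_left has_integral_abs_corrected_trapezoid_kernel assms(1))
  have "norm (integral {c..d} (\<lambda>x. ?p x * f3 x)) \<le> integral {c..d} (\<lambda>x. \<bar>?p x\<bar> * M)"
    using remainder majorant bound
    by (intro integral_norm_bound_integral)
      (auto simp: has_integral_integrable abs_mult intro!: mult_left_mono)
  then show ?thesis
    unfolding integral_unique[OF remainder] integral_unique[OF majorant] real_norm_def by linarith
qed

text \<open>
  Exchanging the end points changes the sign of the whole error: the oriented integral and \<open>h\<close>
  change sign, as does the difference of the slopes, while \<open>h\<^sup>2\<close> and \<open>h\<^sup>4\<close> do not.
\<close>

lemma corrected_trapezoid_error_bound_oriented:
  fixes f f1 f2 f3 :: "real \<Rightarrow> real"
  assumes f1: "\<And>x. x \<in> closed_segment u (u + h) \<Longrightarrow> (f has_real_derivative f1 x) (at x)"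
    and f2: "\<And>x. x \<in> closed_segment u (u + h) \<Longrightarrow> (f1 has_real_derivative f2 x) (at x)"
    and f3: "\<And>x. x \<in> closed_segment u (u + h) \<Longrightarrow> (f2 has_real_derivative f3 x) (at x)"
    and bound: "\<And>x. x \<in> closed_segment u (u + h) \<Longrightarrow> \<bar>f3 x\<bar> \<le> M"
  shows "\<bar>(LBINT x=ereal u..ereal (u + h). f x)
            - h * ((f u + f (u + h)) / 2) - h^2 / 12 * (f1 u - f1 (u + h))\<bar> \<le> h^4 / 192 * M"
proof -
  have cont: "continuous_on (closed_segment u (u + h)) f"
    by (rule DERIV_continuous_on, rule has_field_derivative_at_within, rule f1)
  have LBINT: "(LBINT x=ereal c..ereal d. f x) = integral {c..d} f"
    if "c \<le> d" "{c..d} = closed_segment u (u + h)" for c d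
    using that(1) cont[folded that(2)]
    by (intro interval_integral_eq_integral borel_integrable_atLeastAtMost')
  have error: "\<bar>integral {c..d} f - (d - c) * ((f c + f d) / 2) - (d - c)^2 / 12 * (f1 c - f1 d)\<bar>
      \<le> (d - c)^4 / 192 * M"
    if "c \<le> d" "{c..d} = closed_segment u (u + h)" for c d
    by (rule corrected_trapezoid_error_bound[where ?f2.0 = f2 and ?f3.0 = f3])
      (use that in \<open>auto intro: f1 f2 f3 bound has_field_derivative_at_within\<close>)
  show ?thesis
  proof (cases "h \<ge> 0")
    case True
    then have seg: "{u..u + h} = closed_segment u (u + h)" "u \<le> u + h"
      by (auto simp: closed_segment_eq_real_ivl)
    show ?thesis
      using error[OF seg(2,1)] by (simp add: LBINT[OF seg(2,1)])
  next
    case False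
    then have seg: "{u + h..u} = closed_segment u (u + h)" "u + h \<le> u"
      by (auto simp: closed_segment_eq_real_ivl)
    have "(LBINT x=ereal u..ereal (u + h). f x) = - integral {u + h..u} f"
      by (subst interval_integral_endpoints_reverse) (simp only: LBINT[OF seg(2,1)])
    moreover have "- integral {u + h..u} f - h * ((f u + f (u + h)) / 2)
          - h^2 / 12 * (f1 u - f1 (u + h))
        = - (integral {u + h..u} f - (u - (u + h)) * ((f (u + h) + f u) / 2)
          - (u - (u + h))^2 / 12 * (f1 (u + h) - f1 u))"
      by (simp add: field_simps)
    moreover have "(u - (u + h))^4 = h^4"
      by simp
    ultimately show ?thesis
      using error[OF seg(2,1)] by (simp only: abs_minus_cancel)
  qed
qed

lemma closed_segment_subset_invex:
  assumes "invex_wrt \<eta> A" "u \<in> A" "v \<in> A"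
  shows "closed_segment u (u + \<eta> v u) \<subseteq> A"
proof
  fix x assume "x \<in> closed_segment u (u + \<eta> v u)"
  then obtain t where "t \<in> {0..1}" "x = u + t * \<eta> v u"
    by (auto simp: in_segment algebra_simps)
  then show "x \<in> A"
    using assms by (auto simp: invex_wrt_def)
qed

lemma prequasiinvex_on_segment_le:
  assumes "prequasiinvex_on A \<eta> g" "u \<in> A" "v \<in> A" "x \<in> closed_segment u (u + \<eta> v u)"
  shows "g x \<le> max (g u) (g v)"
proof -
  obtain t where "t \<in> {0..1}" "x = u + t * \<eta> v u"
    using assms(4) by (auto simp: in_segment algebra_simps)
  then show ?thesis
    using assms by (auto simp: prequasiinvex_on_def)
qed

lemma le_powr_inverse_if_powr_le:
  fixes x y q :: real
  assumes "0 \<le> x" "0 < q" "x powr q \<le> y"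
  shows "x \<le> y powr (1 / q)"
proof -
  have "x = (x powr q) powr (1 / q)"
    using assms by (simp add: powr_powr)
  also have "\<dots> \<le> y powr (1 / q)"
    using assms by (intro powr_mono2) auto
  finally show ?thesis .
qed

theorem theorem4:
  fixes A :: "real set"
    and \<eta> :: "real \<Rightarrow> real \<Rightarrow> real"
    and f :: "real \<Rightarrow> real"
    and q a b :: real
  assumes "open A"
    and "invex_wrt \<eta> A"
    and "\<forall>k<3. (deriv ^^ k) f differentiable_on A"
    and "q \<ge> 1"
    and "prequasiinvex_on A \<eta> (\<lambda>x. \<bar>(deriv ^^ 3) f x\<bar> powr q)"
    and "a \<in> A"
    and "b \<in> A"
    and "\<eta> b a \<noteq> 0"
  shows "\<bar>(LBINT x=ereal b..ereal (b + \<eta> a b). f x)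
            - \<eta> a b * ((f b + f (b + \<eta> a b)) / 2)
            - (\<eta> a b)^2 / 12 * (deriv f b - deriv f (b + \<eta> a b))\<bar>
         \<le> (\<eta> a b)^4 / 192
             * (max (\<bar>(deriv ^^ 3) f a\<bar> powr q) (\<bar>(deriv ^^ 3) f b\<bar> powr q)) powr (1 / q)"
proof -
  let ?S = "closed_segment b (b + \<eta> a b)"
  let ?g = "\<lambda>x. \<bar>(deriv ^^ 3) f x\<bar> powr q"
  have derivs: "((deriv ^^ k) f has_real_derivative (deriv ^^ Suc k) f x) (at x)"
    if "k < 3" "x \<in> ?S" for k x
  proof -
    have "x \<in> A"
      using closed_segment_subset_invex[OF assms(2) \<open>b \<in> A\<close> \<open>a \<in> A\<close>] that by blast
    then have "(deriv ^^ k) f differentiable (at x)"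
      using assms(1,3) that by (simp add: differentiable_on_eq_differentiable_at)
    then show ?thesis
      by (simp add: DERIV_deriv_iff_real_differentiable)
  qed
  have bound: "\<bar>(deriv ^^ 3) f x\<bar> \<le> (max (?g a) (?g b)) powr (1 / q)" if "x \<in> ?S" for x
    using prequasiinvex_on_segment_le[OF assms(5) \<open>b \<in> A\<close> \<open>a \<in> A\<close> that] \<open>q \<ge> 1\<close>
    by (intro le_powr_inverse_if_powr_le) (auto simp: max.commute)
  show ?thesis
  proof (rule corrected_trapezoid_error_bound_oriented)
    show "(f has_real_derivative deriv f x) (at x)" if "x \<in> ?S" for x
      using derivs[of 0 x] that by simp
    show "(deriv f has_real_derivative (deriv ^^ 2) f x) (at x)" if "x \<in> ?S" for x
      using derivs[of 1 x] that by (simp add: numeral_2_eq_2)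
    show "((deriv ^^ 2) f has_real_derivative (deriv ^^ 3) f x) (at x)" if "x \<in> ?S" for x
      using derivs[of 2 x] that by (simp add: numeral_3_eq_3 numeral_2_eq_2)
  qed (rule bound)
qed

end
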